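(* Let $D=\{(x,y)\in\mathbb{R}^2 : x^2+y^2\le 1\}$, let $\mu=\rho(\cos\varphi,\sin\varphi)\in D$ be a fixed point with $0\le\rho\le 1$ and $\varphi\in\mathbb{R}$, and let $U$ be a random point uniformly distributed in $D$ (with respect to area). Let $X=(\cos\Theta,\sin\Theta)$ be the shadow cast by $U$ on the boundary circle of $D$ when the light source is at $\mu$, with $\Theta\in[0,2\pi)$. Then the probability distribution of the random angle $\Theta$ is absolutely continuous and is given by $$P(d\theta)=\frac{1-\rho\cos(\theta-\varphi)}{2\pi}\,d\theta ,\qquad 0\le\theta<2\pi .$$
   Context: The shadow $X$ cast by a point $U\in D$, $U\neq\mu$, with light source at $\mu\in D$ is the point where the ray starting at $\mu$ and passing through $U$ meets the unit circle $\{x^2+y^2=1\}$, i.e. the point $\mu+t(U-\mu)$ with $t>0$ lying on the unit circle (it exists and is unique for almost every $U$; the exceptional set, such as $U=\mu$, has probability zero and may be ignored). The angle $\Theta$ is defined by $X=(\cos\Theta,\sin\Theta)$. *)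

theory Defs
  imports "HOL-Probability.Probability"
begin

definition unit_disc :: "(real \<times> real) set" where
  "unit_disc = {(x, y). x\<^sup>2 + y\<^sup>2 \<le> 1}"

definition unit_circle :: "(real \<times> real) set" where
  "unit_circle = {(x, y). x\<^sup>2 + y\<^sup>2 = 1}"

definition is_shadow :: "real \<times> real \<Rightarrow> real \<times> real \<Rightarrow> real \<times> real \<Rightarrow> bool" where
  "is_shadow \<mu> u x \<longleftrightarrow> x \<in> unit_circle \<and> (\<exists>t>0. x = \<mu> + t *\<^sub>R (u - \<mu>))"

(* Both descriptions below are unspecified for the exceptional positions of u without a
   (unique) shadow, e.g. u = \<mu> inside the circle; these carry no mass for a uniform u. *)

definition shadow :: "real \<times> real \<Rightarrow> real \<times> real \<Rightarrow> real \<times> real" where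
  "shadow \<mu> u = (THE x. is_shadow \<mu> u x)"

definition shadow_angle :: "real \<times> real \<Rightarrow> real \<times> real \<Rightarrow> real" where
  "shadow_angle \<mu> u = (THE \<theta>. 0 \<le> \<theta> \<and> \<theta> < 2 * pi \<and> shadow \<mu> u = (cos \<theta>, sin \<theta>))"

end

(* Parametrise the disc by (r, \<theta>) \<mapsto> \<mu> + r (X(\<theta>) - \<mu>), where X(\<theta>) = (cos \<theta>, sin \<theta>).  This map
   is injective off the angle with X(\<theta>) = \<mu>, its image misses only \<mu>, and all points with the
   same \<theta> share the shadow X(\<theta>).  Its Jacobian is r (1 - \<mu> \<bullet> X(\<theta>)) = r (1 - \<rho> cos (\<theta> - \<phi>)), so
   integrating out r \<in> (0, 1] and dividing by the area \<pi> gives the density. *)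

theory Submission
  imports Defs
begin

section \<open>Change of variables for area on \<open>real \<times> real\<close>\<close>

text \<open>The library's multidimensional change of variables is stated for \<open>real^'n\<close> only; these maps
  transport it to \<open>real \<times> real\<close>.\<close>
definition pair_of_vec :: "real^2 \<Rightarrow> real \<times> real" where
  "pair_of_vec v = (v $ 1, v $ 2)"

definition vec_of_pair :: "real \<times> real \<Rightarrow> real^2" where
  "vec_of_pair p = (\<chi> i. if i = 1 then fst p else snd p)"

lemma pair_of_vec_of_pair [simp]: "pair_of_vec (vec_of_pair p) = p"
  by (simp add: pair_of_vec_def vec_of_pair_def)

lemma vec_of_pair_of_vec [simp]: "vec_of_pair (pair_of_vec v) = v"
  by (simp add: pair_of_vec_def vec_of_pair_def vec_eq_iff forall_2)

lemma vec_of_pair_image: "vec_of_pair ` X = pair_of_vec -` X"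
proof (intro equalityI subsetI)
  fix v assume "v \<in> pair_of_vec -` X"
  then show "v \<in> vec_of_pair ` X"
    by (intro image_eqI[of _ _ "pair_of_vec v"]) auto
qed auto

lemma bounded_linear_pair_of_vec: "bounded_linear pair_of_vec"
  unfolding pair_of_vec_def [abs_def]
  by (intro bounded_linear_Pair bounded_linear_vec_nth)

lemma linear_vec_of_pair: "linear vec_of_pair"
  by (rule linearI) (auto simp: vec_of_pair_def vec_eq_iff)

lemma bounded_linear_vec_of_pair: "bounded_linear vec_of_pair"
  using linear_vec_of_pair by (simp add: linear_conv_bounded_linear)

lemma measurable_pair_of_vec [measurable]: "pair_of_vec \<in> borel_measurable borel"
  by (intro borel_measurable_continuous_onI linear_continuous_on bounded_linear_pair_of_vec)

text \<open>Lebesgue measure is determined by its values on boxes, and the preimage of a box is a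
  box with the same side lengths.\<close>

lemma distr_lborel_pair_of_vec: "distr lborel borel pair_of_vec = lborel"
proof (rule lborel_eqI [symmetric])
  fix l u :: "real \<times> real"
  assume le: "\<And>b. b \<in> Basis \<Longrightarrow> l \<bullet> b \<le> u \<bullet> b"
  have le1: "fst l \<le> fst u" and le2: "snd l \<le> snd u"
    using le[of "(1, 0)"] le[of "(0, 1)"] by (auto simp: Basis_prod_def inner_prod_def)
  have box_eq: "pair_of_vec -` box l u = box (vec_of_pair l) (vec_of_pair u)"
    by (auto simp: set_eq_iff mem_box_cart forall_2 mem_box(1) Basis_prod_def inner_prod_def
                   ball_Un vec_of_pair_def pair_of_vec_def)
  have "emeasure (distr lborel borel pair_of_vec) (box l u) =
      emeasure lborel (box (vec_of_pair l) (vec_of_pair u))"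
    by (subst emeasure_distr) (auto simp: box_eq)
  also have "\<dots> = ennreal (\<Prod>b\<in>Basis. (vec_of_pair u - vec_of_pair l) \<bullet> b)"
    by (rule emeasure_lborel_box)
       (auto simp: Basis_vec_def inner_axis vec_of_pair_def le1 le2)
  also have "(\<Prod>b\<in>Basis. (vec_of_pair u - vec_of_pair l) \<bullet> b) = (\<Prod>b\<in>Basis. (u - l) \<bullet> b)"
  proof -
    have 1: "(Basis :: (real^2) set) = {axis 1 1, axis 2 1}"
      by (auto simp: Basis_vec_def UNIV_2)
    have 2: "(Basis :: (real \<times> real) set) = {(1, 0), (0, 1)}"
      by (auto simp: Basis_prod_def)
    show ?thesis
      unfolding 1 2
      by (subst (1 2) prod.insert)
         (auto simp: axis_eq_axis inner_axis vec_of_pair_def inner_prod_def)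
  qed
  finally show "emeasure (distr lborel borel pair_of_vec) (box l u) =
      ennreal (\<Prod>b\<in>Basis. (u - l) \<bullet> b)" .
qed simp

text \<open>The map is conjugated by the measure-preserving isomorphism with \<open>real^2\<close>,
  where \<open>has_measure_differentiable_image\<close> applies. The functions \<open>a\<close>,
  \<open>b\<close>, \<open>c\<close>, \<open>d\<close> are the entries of the Jacobian matrix, so
  the integrand is the absolute value of its determinant.\<close>

lemma emeasure_lborel_image_real2:
  fixes g :: "real \<times> real \<Rightarrow> real \<times> real" and a b c d :: "real \<times> real \<Rightarrow> real"
  assumes S [measurable]: "S \<in> sets borel" and gS [measurable]: "g ` S \<in> sets borel"
    and der: "\<And>x. x \<in> S \<Longrightarrow>
      (g has_derivative (\<lambda>(h, k). (a x * h + b x * k, c x * h + d x * k))) (at x within S)"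
    and inj: "inj_on g S"
    and J [measurable]: "(\<lambda>x. a x * d x - b x * c x) \<in> borel_measurable borel"
    and fin: "(\<integral>\<^sup>+x\<in>S. ennreal \<bar>a x * d x - b x * c x\<bar> \<partial>lborel) < \<infinity>"
  shows "emeasure lborel (g ` S) = (\<integral>\<^sup>+x\<in>S. ennreal \<bar>a x * d x - b x * c x\<bar> \<partial>lborel)"
proof -
  \<comment> \<open>\<open>has_measure_differentiable_image\<close> speaks of a real-valued
    integral, so finiteness is used to name the value by a real number.\<close>
  obtain m where m: "(\<integral>\<^sup>+x\<in>S. ennreal \<bar>a x * d x - b x * c x\<bar> \<partial>lborel) = ennreal m" "0 \<le> m"
    using fin by (cases rule: ennreal_cases) auto
  let ?T = pair_of_vec and ?V = vec_of_pair
  define S' where "S' = ?T -` S"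
  define G where "G x = (\<lambda>(h, k). (a x * h + b x * k, c x * h + d x * k))" for x
  define f where "f v = ?V (g (?T v))" for v
  define f' where "f' v = (\<lambda>w. ?V (G (?T v) (?T w)))" for v
  have [measurable]: "S' \<in> sets borel"
    using measurable_sets[OF measurable_pair_of_vec S] by (simp add: S'_def)
  have TS': "?T ` S' = S"
    using surjI[of ?T ?V] by (simp add: S'_def surj_image_vimage_eq)
  have fS': "f ` S' = ?T -` (g ` S)"
  proof -
    have "f ` S' = ?V ` g ` ?T ` S'"
      by (simp add: f_def image_image)
    then show ?thesis
      by (simp add: TS' vec_of_pair_image)
  qed
  have der': "(f has_derivative f' v) (at v within S')" if "v \<in> S'" for v
  proof -
    have "(g has_derivative G (?T v)) (at (?T v) within ?T ` S')"
      using der that unfolding TS' G_def by (auto simp: S'_def)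
    then have "((\<lambda>v. g (?T v)) has_derivative (\<lambda>w. G (?T v) (?T w))) (at v within S')"
      by (rule has_derivative_in_compose
               [OF bounded_linear_imp_has_derivative[OF bounded_linear_pair_of_vec]])
    then show ?thesis
      unfolding f_def [abs_def] f'_def
      by (rule bounded_linear.has_derivative[OF bounded_linear_vec_of_pair])
  qed
  have inj': "inj_on f S'"
  proof (rule inj_onI)
    fix v w assume *: "v \<in> S'" "w \<in> S'" "f v = f w"
    then have "g (?T v) = g (?T w)"
      unfolding f_def by (metis pair_of_vec_of_pair)
    with * inj have "?T v = ?T w" by (auto simp: S'_def dest: inj_onD)
    then show "v = w" by (metis vec_of_pair_of_vec)
  qed
  have det: "det (matrix (f' v)) = a (?T v) * d (?T v) - b (?T v) * c (?T v)" for v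
    by (simp add: det_2 matrix_def f'_def G_def vec_of_pair_def pair_of_vec_def axis_def)
  define j where "j x = indicator S x * \<bar>a x * d x - b x * c x\<bar>" for x
  have [measurable]: "j \<in> borel_measurable borel"
    unfolding j_def by measurable
  have "(\<integral>\<^sup>+v. ennreal (j (?T v)) \<partial>lborel) = (\<integral>\<^sup>+x. ennreal (j x) \<partial>distr lborel borel ?T)"
    by (subst nn_integral_distr) auto
  also have "\<dots> = ennreal m"
    unfolding distr_lborel_pair_of_vec m(1) [symmetric]
    by (intro nn_integral_cong) (auto simp: j_def split: split_indicator)
  \<comment> \<open>For a nonnegative measurable function, a finite Lebesgue integral is also a
    gauge integral, the form needed for the change of variables.\<close>
  finally have "((\<lambda>v. j (?T v)) has_integral m) UNIV"
    by (intro nn_integral_has_integral) (auto simp: j_def m(2))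
  also have "(\<lambda>v. j (?T v)) = (\<lambda>v. if v \<in> S' then \<bar>det (matrix (f' v))\<bar> else 0)"
    by (auto simp: j_def S'_def det)
  finally have "((\<lambda>v. \<bar>det (matrix (f' v))\<bar>) has_integral m) S'"
    by (simp only: has_integral_restrict_UNIV)
  then have f: "f ` S' \<in> lmeasurable" "measure lebesgue (f ` S') = m"
    using has_measure_differentiable_image[OF _ der' inj', of m] by auto
  have "emeasure lborel (g ` S) = emeasure (distr lborel borel ?T) (g ` S)"
    by (simp add: distr_lborel_pair_of_vec)
  also have "\<dots> = emeasure lborel (f ` S')"
    by (subst emeasure_distr) (auto simp: fS')
  also have "\<dots> = emeasure lebesgue (f ` S')"
    using measurable_sets[OF measurable_pair_of_vec gS] by (simp add: fS')
  also have "\<dots> = ennreal m"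
    using emeasure_eq_measure2[OF f(1)] f(2) by simp
  finally show ?thesis
    by (simp only: m(1))
qed

section \<open>Intersection of a ray from the light source with the circle\<close>

lemma unit_circle_iff_inner: "x \<in> unit_circle \<longleftrightarrow> x \<bullet> x = 1"
  by (cases x) (simp add: unit_circle_def power2_eq_square)

lemma unit_disc_iff_inner: "x \<in> unit_disc \<longleftrightarrow> x \<bullet> x \<le> 1"
  by (cases x) (simp add: unit_disc_def power2_eq_square)

lemma unit_disc_eq_cball: "unit_disc = cball 0 1"
  by (auto simp: unit_disc_iff_inner norm_le_square)

text \<open>The larger root \<open>t\<close> of the quadratic equation \<open>\<bar>\<mu> + t (u - \<mu>)\<bar>\<^sup>2 = 1\<close>.\<close>
definition shadow_param :: "real \<times> real \<Rightarrow> real \<times> real \<Rightarrow> real" where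
  "shadow_param \<mu> u =
    (sqrt ((\<mu> \<bullet> (u - \<mu>))\<^sup>2 + ((u - \<mu>) \<bullet> (u - \<mu>)) * (1 - \<mu> \<bullet> \<mu>)) - \<mu> \<bullet> (u - \<mu>))
      / ((u - \<mu>) \<bullet> (u - \<mu>))"

text \<open>The product of the roots is \<open>- c / a \<le> 0\<close>, so only the larger root can
  be positive. The proof completes the square.\<close>

lemma positive_quadratic_root_iff:
  fixes a b c t :: real
  assumes "0 < a" "0 \<le> c" "0 < t"
  shows "a * t\<^sup>2 + 2 * b * t = c \<longleftrightarrow> t = (sqrt (b\<^sup>2 + a * c) - b) / a"
proof
  assume *: "a * t\<^sup>2 + 2 * b * t = c"
  \<comment> \<open>This factorisation settles the sign of the square root:
    \<open>a * t + 2 * b\<close> and \<open>a * t\<close> are nonnegative, hence so is their mean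
    \<open>a * t + b\<close>.\<close>
  have "t * (a * t + 2 * b) = c"
    using * by (simp add: power2_eq_square algebra_simps)
  then have "0 \<le> t * (a * t + 2 * b)"
    using assms by simp
  then have "0 \<le> a * t + 2 * b"
    using assms(3) by (auto simp: zero_le_mult_iff)
  moreover have "0 < a * t"
    using assms by simp
  ultimately have "0 \<le> a * t + b"
    by linarith
  moreover have "b\<^sup>2 + a * c = (a * t + b)\<^sup>2"
    unfolding * [symmetric] by (simp add: power2_eq_square algebra_simps)
  ultimately have "sqrt (b\<^sup>2 + a * c) = a * t + b"
    by simp
  then show "t = (sqrt (b\<^sup>2 + a * c) - b) / a"
    using assms by simp
next
  assume "t = (sqrt (b\<^sup>2 + a * c) - b) / a"
  then have "a * t + b = sqrt (b\<^sup>2 + a * c)"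
    using assms by (simp add: field_simps)
  then have "(a * t + b)\<^sup>2 = b\<^sup>2 + a * c"
    using assms by simp
  then have "a * (a * t\<^sup>2 + 2 * b * t) = a * c"
    by (simp add: power2_eq_square algebra_simps)
  then show "a * t\<^sup>2 + 2 * b * t = c"
    using assms by simp
qed

text \<open>Meeting the circle is a quadratic condition on \<open>t\<close> with right-hand side
  \<open>1 - \<mu> \<bullet> \<mu> \<ge> 0\<close>, so at most one positive \<open>t\<close> solves
  it. The root is 0, and no shadow exists, when \<open>\<mu>\<close> lies on the circle and
  \<open>\<mu> \<bullet> (u - \<mu>) \<ge> 0\<close>.\<close>

lemma is_shadow_iff:
  assumes "\<mu> \<in> unit_disc" "u \<noteq> \<mu>"
  shows "is_shadow \<mu> u x \<longleftrightarrow>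
    0 < shadow_param \<mu> u \<and> x = \<mu> + shadow_param \<mu> u *\<^sub>R (u - \<mu>)"
proof -
  let ?d = "u - \<mu>"
  have "\<mu> + t *\<^sub>R ?d \<in> unit_circle \<longleftrightarrow> t = shadow_param \<mu> u" if "0 < t" for t
  proof -
    have "(\<mu> + t *\<^sub>R ?d) \<bullet> (\<mu> + t *\<^sub>R ?d) = \<mu> \<bullet> \<mu> + 2 * (\<mu> \<bullet> ?d) * t + (?d \<bullet> ?d) * t\<^sup>2"
      by (simp add: inner_add_left inner_add_right inner_commute power2_eq_square)
    then have "\<mu> + t *\<^sub>R ?d \<in> unit_circle \<longleftrightarrow>
        (?d \<bullet> ?d) * t\<^sup>2 + 2 * (\<mu> \<bullet> ?d) * t = 1 - \<mu> \<bullet> \<mu>"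
      unfolding unit_circle_iff_inner by auto
    also have "\<dots> \<longleftrightarrow> t = shadow_param \<mu> u"
      unfolding shadow_param_def
      using assms that
      by (intro positive_quadratic_root_iff) (auto simp: unit_disc_iff_inner)
    finally show ?thesis .
  qed
  then show ?thesis
    unfolding is_shadow_def by auto
qed

text \<open>The ray passes through \<open>u\<close> at parameter 1, still inside the disc, so the
  quadratic is at most 0 there and its larger root is not smaller than 1.\<close>

lemma shadow_param_ge_1:
  assumes "u \<in> unit_disc" "u \<noteq> \<mu>"
  shows "1 \<le> shadow_param \<mu> u"
proof -
  let ?a = "(u - \<mu>) \<bullet> (u - \<mu>)" and ?b = "\<mu> \<bullet> (u - \<mu>)"
  have "?a + 2 * ?b = u \<bullet> u - \<mu> \<bullet> \<mu>"
    by (simp add: inner_diff_left inner_diff_right inner_commute)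
  then have "?a + 2 * ?b \<le> 1 - \<mu> \<bullet> \<mu>"
    using assms by (simp add: unit_disc_iff_inner)
  then have "?a * (?a + 2 * ?b) \<le> ?a * (1 - \<mu> \<bullet> \<mu>)"
    by (intro mult_left_mono) auto
  moreover have "(x + y)\<^sup>2 = y\<^sup>2 + x * (x + 2 * y)" for x y :: real
    by (simp add: power2_eq_square algebra_simps)
  ultimately have "(?a + ?b)\<^sup>2 \<le> ?b\<^sup>2 + ?a * (1 - \<mu> \<bullet> \<mu>)"
    by (metis add_left_mono)
  then have "?a + ?b \<le> sqrt (?b\<^sup>2 + ?a * (1 - \<mu> \<bullet> \<mu>))"
    by (rule real_le_rsqrt)
  moreover have "0 < ?a"
    using assms by simp
  ultimately show ?thesis
    unfolding shadow_param_def by (simp only: pos_le_divide_eq)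
qed

section \<open>Angles of points on the circle\<close>

definition circle_angle :: "real \<times> real \<Rightarrow> real" where
  "circle_angle p =
    (let \<alpha> = arccos (max (- 1) (min 1 (fst p))) in if 0 \<le> snd p then \<alpha> else 2 * pi - \<alpha>)"

lemma circle_angle_cos_sin:
  assumes "0 \<le> \<theta>" "\<theta> < 2 * pi"
  shows "circle_angle (cos \<theta>, sin \<theta>) = \<theta>"
proof (cases "\<theta> \<le> pi")
  case True
  then show ?thesis
    using assms by (simp add: circle_angle_def sin_ge_zero arccos_cos)
next
  case False
  then have "sin \<theta> < 0"
    using assms by (intro sin_lt_zero) auto
  moreover have "arccos (cos \<theta>) = 2 * pi - \<theta>"
    using arccos_cos[of "2 * pi - \<theta>"] False assms by (simp add: cos_diff)
  ultimately show ?thesis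
    by (simp add: circle_angle_def)
qed

lemma borel_measurable_circle_angle [measurable]: "circle_angle \<in> borel_measurable borel"
proof -
  \<comment> \<open>Clamping the first coordinate to \<open>[-1, 1]\<close> keeps
    \<open>arccos\<close> continuous on the whole plane, not only for points of the circle.\<close>
  have "continuous_on UNIV (\<lambda>p :: real \<times> real. arccos (max (- 1) (min 1 (fst p))))"
    by (intro continuous_intros) auto
  then have [measurable]:
    "(\<lambda>p :: real \<times> real. arccos (max (- 1) (min 1 (fst p)))) \<in> borel_measurable borel"
    by (rule borel_measurable_continuous_onI)
  have [measurable]: "(snd :: real \<times> real \<Rightarrow> real) \<in> borel_measurable borel"
    by (intro borel_measurable_continuous_onI continuous_intros)
  show ?thesis
    unfolding circle_angle_def [abs_def] Let_def by measurable
qed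

lemma unit_circle_eq_circle_angle:
  assumes "p \<in> unit_circle"
  shows "0 \<le> circle_angle p" "circle_angle p < 2 * pi"
    "p = (cos (circle_angle p), sin (circle_angle p))"
proof -
  obtain \<theta> where "0 \<le> \<theta>" "\<theta> < 2 * pi" "p = (cos \<theta>, sin \<theta>)"
    using assms by (cases p) (auto simp: unit_circle_def elim!: sincos_total_2pi)
  then show "0 \<le> circle_angle p" "circle_angle p < 2 * pi"
    "p = (cos (circle_angle p), sin (circle_angle p))"
    by (simp_all add: circle_angle_cos_sin)
qed

section \<open>The shadow angle as a Borel function\<close>

lemma shadow_eqI:
  assumes "\<mu> \<in> unit_disc" "u \<noteq> \<mu>" "is_shadow \<mu> u x"
  shows "shadow \<mu> u = x"
  unfolding shadow_def using assms by (intro the_equality) (auto simp: is_shadow_iff)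

lemma shadow_angle_eq_circle_angle:
  assumes "\<mu> \<in> unit_disc" "u \<noteq> \<mu>" "is_shadow \<mu> u x"
  shows "shadow_angle \<mu> u = circle_angle x"
proof -
  have "x \<in> unit_circle"
    using assms by (simp add: is_shadow_def)
  then show ?thesis
    unfolding shadow_angle_def shadow_eqI[OF assms]
    using unit_circle_eq_circle_angle[of x]
    by (intro the_equality) (auto simp: circle_angle_cos_sin)
qed

text \<open>The definite descriptions are replaced by a closed formula wherever a shadow exists;
  elsewhere the value is constant.\<close>

lemma borel_measurable_shadow_angle:
  assumes "\<mu> \<in> unit_disc"
  shows "shadow_angle \<mu> \<in> borel_measurable borel"
proof -
  \<comment> \<open>Where no shadow exists, \<open>is_shadow \<mu> u\<close> is the constantly false
    predicate, so the nested descriptions give the same value \<open>K\<close> for all such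
    \<open>u\<close>.\<close>
  define K where "K = (THE \<theta>. 0 \<le> \<theta> \<and> \<theta> < 2 * pi \<and> (THE x. False) = (cos \<theta>, sin \<theta>))"
  have eq: "shadow_angle \<mu> u =
      (if u = \<mu> then shadow_angle \<mu> \<mu>
       else if 0 < shadow_param \<mu> u then circle_angle (\<mu> + shadow_param \<mu> u *\<^sub>R (u - \<mu>))
       else K)" for u
    using shadow_angle_eq_circle_angle[OF assms] is_shadow_iff[OF assms]
    by (auto simp: K_def shadow_angle_def shadow_def)
  have [measurable]: "shadow_param \<mu> \<in> borel_measurable borel"
    unfolding shadow_param_def [abs_def] by measurable
  show ?thesis
    by (subst eq [abs_def]) measurable
qed

section \<open>Polar coordinates centred at the light source\<close>

definition polar_map :: "real \<times> real \<Rightarrow> real \<times> real \<Rightarrow> real \<times> real" where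
  "polar_map \<mu> = (\<lambda>(r, \<theta>). \<mu> + r *\<^sub>R ((cos \<theta>, sin \<theta>) - \<mu>))"

lemma has_derivative_polar_map:
  "(polar_map \<mu> has_derivative
     (\<lambda>(h, k). ((cos (snd x) - fst \<mu>) * h + (- (fst x * sin (snd x))) * k,
                (sin (snd x) - snd \<mu>) * h + (fst x * cos (snd x)) * k))) (at x within S)"
proof -
  have eq: "polar_map \<mu> = (\<lambda>x. (fst \<mu> + fst x * (cos (snd x) - fst \<mu>),
                              snd \<mu> + fst x * (sin (snd x) - snd \<mu>)))"
    by (auto simp: polar_map_def fun_eq_iff prod_eq_iff)
  show ?thesis
    unfolding eq
    by (auto intro!: derivative_eq_intros simp: fun_eq_iff algebra_simps)
qed

text \<open>The point lies on the segment from \<open>\<mu>\<close> to the boundary point, so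
  convexity keeps it in the disc; stretching by \<open>1 / r\<close> leads back to the
  boundary.\<close>

lemma polar_map_shadow:
  assumes \<mu>: "\<mu> \<in> unit_disc" and r: "0 < r" "r \<le> 1" and X: "(cos \<theta>, sin \<theta>) \<noteq> \<mu>"
  shows "polar_map \<mu> (r, \<theta>) \<in> unit_disc" "polar_map \<mu> (r, \<theta>) \<noteq> \<mu>"
    "is_shadow \<mu> (polar_map \<mu> (r, \<theta>)) (cos \<theta>, sin \<theta>)"
proof -
  let ?X = "(cos \<theta>, sin \<theta>)"
  have circle: "?X \<in> unit_circle"
    by (simp add: unit_circle_def)
  then have "?X \<in> unit_disc"
    by (simp add: unit_disc_iff_inner unit_circle_iff_inner)
  moreover have "convex unit_disc"
    by (simp add: unit_disc_eq_cball)
  ultimately have "(1 - r) *\<^sub>R \<mu> + r *\<^sub>R ?X \<in> unit_disc"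
    using \<mu> r by (intro convexD_alt) auto
  then show "polar_map \<mu> (r, \<theta>) \<in> unit_disc"
    by (simp only: polar_map_def prod.case) (simp add: algebra_simps)
  show "polar_map \<mu> (r, \<theta>) \<noteq> \<mu>"
    using r X unfolding polar_map_def prod.case
    by (metis add_cancel_left_right eq_iff_diff_eq_0 less_irrefl scaleR_eq_0_iff)
  show "is_shadow \<mu> (polar_map \<mu> (r, \<theta>)) ?X"
    unfolding is_shadow_def
  proof (intro conjI circle exI[of _ "1 / r"])
    show "?X = \<mu> + (1 / r) *\<^sub>R (polar_map \<mu> (r, \<theta>) - \<mu>)"
      using r by (simp only: polar_map_def prod.case add_diff_cancel_left' scaleR_scaleR) simp
  qed (use r in simp)
qed

lemma shadow_angle_polar_map:
  assumes "\<mu> \<in> unit_disc" "0 < r" "r \<le> 1" "(cos \<theta>, sin \<theta>) \<noteq> \<mu>" "0 \<le> \<theta>" "\<theta> < 2 * pi"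
  shows "shadow_angle \<mu> (polar_map \<mu> (r, \<theta>)) = \<theta>"
  using shadow_angle_eq_circle_angle[OF assms(1) polar_map_shadow(2,3)[OF assms(1-4)]] assms(5,6)
  by (simp add: circle_angle_cos_sin)

text \<open>In these coordinates a condition on the shadow angle alone becomes a product set, so
  that the integral over it factors. The inverse map sends \<open>u\<close> to
  \<open>(1 / t, \<theta>)\<close> with \<open>t = shadow_param \<mu> u\<close>.\<close>

lemma polar_map_image:
  assumes \<mu>: "\<mu> \<in> unit_disc"
  shows "polar_map \<mu> ` ({0<..1} \<times> {\<theta> \<in> A. 0 \<le> \<theta> \<and> \<theta> < 2 * pi \<and> (cos \<theta>, sin \<theta>) \<noteq> \<mu>}) =
    {u \<in> unit_disc - {\<mu>}. shadow_angle \<mu> u \<in> A}"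
    (is "_ ` ?S = ?B")
proof (intro equalityI subsetI)
  fix u assume "u \<in> polar_map \<mu> ` ?S"
  then obtain r \<theta> where "u = polar_map \<mu> (r, \<theta>)" "0 < r" "r \<le> 1" "\<theta> \<in> A" "0 \<le> \<theta>" "\<theta> < 2 * pi"
    "(cos \<theta>, sin \<theta>) \<noteq> \<mu>" by auto
  then show "u \<in> ?B"
    using polar_map_shadow[OF \<mu>] shadow_angle_polar_map[OF \<mu>] by auto
next
  fix u assume "u \<in> ?B"
  then have u: "u \<in> unit_disc" "u \<noteq> \<mu>" "shadow_angle \<mu> u \<in> A" by auto
  define t where "t = shadow_param \<mu> u"
  define x where "x = \<mu> + t *\<^sub>R (u - \<mu>)"
  have t: "1 \<le> t"
    unfolding t_def using u by (intro shadow_param_ge_1)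
  then have sh: "is_shadow \<mu> u x"
    using is_shadow_iff[OF \<mu> u(2)] by (auto simp: t_def x_def)
  define \<theta> where "\<theta> = shadow_angle \<mu> u"
  have \<theta>: "0 \<le> \<theta>" "\<theta> < 2 * pi" "x = (cos \<theta>, sin \<theta>)"
    using sh unit_circle_eq_circle_angle[of x]
    by (auto simp: \<theta>_def shadow_angle_eq_circle_angle[OF \<mu> u(2) sh] is_shadow_def)
  have "x \<noteq> \<mu>"
    using t u by (auto simp: x_def)
  \<comment> \<open>The bound \<open>1 \<le> t\<close> is what places the radius
    \<open>1 / t\<close> in \<open>{0<..1}\<close>.\<close>
  then have "(1 / t, \<theta>) \<in> ?S"
    using t u(3) \<theta> by (simp only: mem_Times_iff fst_conv snd_conv mem_Collect_eq \<theta>_def [symmetric]) simp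
  moreover have "u = polar_map \<mu> (1 / t, \<theta>)"
    unfolding polar_map_def prod.case \<theta>(3) [symmetric] using t by (simp add: x_def)
  ultimately show "u \<in> polar_map \<mu> ` ?S"
    by (rule rev_image_eqI)
qed

text \<open>The shadow angle of the image recovers \<open>\<theta>\<close>; then \<open>r\<close> is
  recovered because the direction vector from \<open>\<mu>\<close> to the boundary point is
  nonzero.\<close>

lemma inj_on_polar_map:
  assumes \<mu>: "\<mu> \<in> unit_disc"
  shows "inj_on (polar_map \<mu>) ({0<..1} \<times> {\<theta>. 0 \<le> \<theta> \<and> \<theta> < 2 * pi \<and> (cos \<theta>, sin \<theta>) \<noteq> \<mu>})"
proof (rule inj_onI, clarify)
  fix r \<theta> r' \<theta>'
  assume *: "r \<in> {0<..1}" "r' \<in> {0<..1}" "0 \<le> \<theta>" "\<theta> < 2 * pi" "0 \<le> \<theta>'" "\<theta>' < 2 * pi"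
    "(cos \<theta>, sin \<theta>) \<noteq> \<mu>" "(cos \<theta>', sin \<theta>') \<noteq> \<mu>" "polar_map \<mu> (r, \<theta>) = polar_map \<mu> (r', \<theta>')"
  have "shadow_angle \<mu> (polar_map \<mu> (r, \<theta>)) = \<theta>" "shadow_angle \<mu> (polar_map \<mu> (r', \<theta>')) = \<theta>'"
    by (rule shadow_angle_polar_map[OF \<mu>]; use * in simp)+
  with * have "\<theta> = \<theta>'" by simp
  moreover from this have "r *\<^sub>R ((cos \<theta>, sin \<theta>) - \<mu>) = r' *\<^sub>R ((cos \<theta>, sin \<theta>) - \<mu>)"
    using * by (simp only: polar_map_def prod.case) simp
  then have "r = r'"
    using * by (simp only: scaleR_cancel_right) simp
  ultimately show "r = r' \<and> \<theta> = \<theta>'" by simp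
qed

text \<open>Cauchy-Schwarz; this bound makes both the Jacobian and the claimed density
  nonnegative.\<close>

lemma inner_disc_circle_le_1:
  assumes "\<mu> \<in> unit_disc"
  shows "\<mu> \<bullet> (cos \<theta>, sin \<theta>) \<le> 1"
proof -
  have "\<mu> \<bullet> (cos \<theta>, sin \<theta>) \<le> norm \<mu> * norm (cos \<theta>, sin \<theta>)"
    by (rule norm_cauchy_schwarz)
  also have "\<dots> \<le> 1"
    using assms by (simp add: unit_disc_eq_cball norm_Pair)
  finally show ?thesis .
qed

section \<open>Area of the set of points with prescribed shadow angles\<close>

lemma nn_integral_id_unit_interval:
  "(\<integral>\<^sup>+r. ennreal r * indicator {0<..1::real} r \<partial>lborel) = ennreal (1 / 2)"
proof -
  have "(\<integral>\<^sup>+r. ennreal r * indicator {0<..1::real} r \<partial>lborel) =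
      (\<integral>\<^sup>+r. ennreal r * indicator {0..1} r \<partial>lborel)"
    by (intro nn_integral_cong) (auto split: split_indicator)
  also have "\<dots> = ennreal (1\<^sup>2 / 2 - 0\<^sup>2 / 2)"
    by (intro nn_integral_FTC_Icc[where F = "\<lambda>r. r\<^sup>2 / 2"])
       (auto intro!: derivative_eq_intros)
  finally show ?thesis by simp
qed

text \<open>The change of variables turns the area into the integral of
  \<open>r * \<delta> \<theta>\<close> over a product set; Tonelli separates it, and the radial
  factor contributes \<open>1 / 2\<close>.\<close>

lemma emeasure_shadow_angle:
  assumes \<mu>: "\<mu> \<in> unit_disc" and A [measurable]: "A \<in> sets borel"
  shows "emeasure lborel {u \<in> unit_disc - {\<mu>}. shadow_angle \<mu> u \<in> A} =
    ennreal (1 / 2) * (\<integral>\<^sup>+\<theta>\<in>A \<inter> {0..<2 * pi}. ennreal (1 - \<mu> \<bullet> (cos \<theta>, sin \<theta>)) \<partial>lborel)"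
    (is "emeasure lborel ?B = _")
proof -
  define A' where "A' = {\<theta> \<in> A. 0 \<le> \<theta> \<and> \<theta> < 2 * pi \<and> (cos \<theta>, sin \<theta>) \<noteq> \<mu>}"
  define \<delta> where "\<delta> \<theta> = 1 - \<mu> \<bullet> (cos \<theta>, sin \<theta>)" for \<theta>
  let ?S = "{0<..1::real} \<times> A'"
  let ?J = "\<lambda>x. (cos (snd x) - fst \<mu>) * (fst x * cos (snd x)) -
                (- (fst x * sin (snd x))) * (sin (snd x) - snd \<mu>)"
  have [measurable]: "(\<lambda>\<theta>. (cos \<theta>, sin \<theta>)) \<in> borel_measurable (borel :: real measure)"
    by (intro borel_measurable_continuous_onI continuous_intros)
  have [measurable]: "\<delta> \<in> borel_measurable borel"
    unfolding \<delta>_def [abs_def] by measurable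
  have [measurable]: "A' \<in> sets borel"
    unfolding A'_def by measurable
  have [measurable]: "shadow_angle \<mu> \<in> borel_measurable borel"
    by (rule borel_measurable_shadow_angle[OF \<mu>])
  have [measurable]: "unit_disc \<in> sets borel"
    by (simp add: unit_disc_eq_cball)
  have S: "?S \<in> sets borel"
    by (intro borel_Times) auto
  have B: "?B \<in> sets borel"
    by measurable
  have image: "polar_map \<mu> ` ?S = ?B"
    unfolding A'_def by (rule polar_map_image[OF \<mu>])
  have [simp]: "0 \<le> \<delta> \<theta>" for \<theta>
    using inner_disc_circle_le_1[OF \<mu>] by (simp add: \<delta>_def)
  \<comment> \<open>The determinant collapses by the Pythagorean identity. The simp rules for it are
    disabled first, so that both sides are compared as polynomials in sine and cosine.\<close>
  have J: "?J x = fst x * \<delta> (snd x)" for x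
  proof -
    have "?J x = fst x * ((sin (snd x))\<^sup>2 + (cos (snd x))\<^sup>2 - \<mu> \<bullet> (cos (snd x), sin (snd x)))"
      by (cases \<mu>) (simp add: power2_eq_square algebra_simps
                     del: sin_cos_squared_add sin_cos_squared_add2 sin_cos_squared_add3)
    then show ?thesis
      by (simp add: \<delta>_def)
  qed
  have "(\<integral>\<^sup>+x\<in>?S. ennreal \<bar>?J x\<bar> \<partial>lborel) =
      (\<integral>\<^sup>+x. (ennreal (fst x) * indicator {0<..1} (fst x)) *
             (ennreal (\<delta> (snd x)) * indicator A' (snd x)) \<partial>(lborel \<Otimes>\<^sub>M lborel))"
    unfolding J lborel_prod
    by (intro nn_integral_cong) (auto simp: abs_mult ennreal_mult split: split_indicator)
  also have "\<dots> = (\<integral>\<^sup>+r. \<integral>\<^sup>+\<theta>. (ennreal r * indicator {0<..1} r) *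
             (ennreal (\<delta> \<theta>) * indicator A' \<theta>) \<partial>lborel \<partial>lborel)"
    by (subst lborel.nn_integral_fst [symmetric]) simp_all
  also have "\<dots> = ennreal (1 / 2) * (\<integral>\<^sup>+\<theta>. ennreal (\<delta> \<theta>) * indicator A' \<theta> \<partial>lborel)"
    by (simp add: nn_integral_cmult nn_integral_multc nn_integral_id_unit_interval)
  finally have int: "(\<integral>\<^sup>+x\<in>?S. ennreal \<bar>?J x\<bar> \<partial>lborel) =
      ennreal (1 / 2) * (\<integral>\<^sup>+\<theta>. ennreal (\<delta> \<theta>) * indicator A' \<theta> \<partial>lborel)" .
  \<comment> \<open>A crude bound suffices for finiteness: the integrand is at most 2 on an interval
    of length \<open>2 * pi\<close>.\<close>
  have "(\<integral>\<^sup>+\<theta>. ennreal (\<delta> \<theta>) * indicator A' \<theta> \<partial>lborel) \<le>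
      (\<integral>\<^sup>+\<theta>. ennreal 2 * indicator {0..2 * pi} \<theta> \<partial>lborel)"
  proof (intro nn_integral_mono mult_mono)
    fix \<theta>
    \<comment> \<open>Applying the upper bound at the antipodal angle \<open>\<theta> + pi\<close>
      flips the sign of the inner product and so bounds it below by \<open>-1\<close>.\<close>
    have "\<delta> \<theta> \<le> 2"
      using inner_disc_circle_le_1[OF \<mu>, of "\<theta> + pi"] by (cases \<mu>) (simp add: \<delta>_def)
    then show "ennreal (\<delta> \<theta>) \<le> ennreal 2"
      by (rule ennreal_leI)
  qed (auto simp: A'_def split: split_indicator)
  also have "\<dots> < \<infinity>"
    by (simp add: nn_integral_cmult_indicator ennreal_mult_less_top)
  finally have fin: "(\<integral>\<^sup>+x\<in>?S. ennreal \<bar>?J x\<bar> \<partial>lborel) < \<infinity>"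
    unfolding int infinity_ennreal_def
    by (intro ennreal_mult_less_top[THEN iffD2] disjI2 conjI ennreal_less_top) simp
  have "emeasure lborel (polar_map \<mu> ` ?S) = (\<integral>\<^sup>+x\<in>?S. ennreal \<bar>?J x\<bar> \<partial>lborel)"
  proof (rule emeasure_lborel_image_real2[OF S _ has_derivative_polar_map])
    show "polar_map \<mu> ` ?S \<in> sets borel"
      using B by (simp add: image)
    show "inj_on (polar_map \<mu>) ?S"
      by (rule inj_on_subset[OF inj_on_polar_map[OF \<mu>]]) (auto simp: A'_def)
    show "?J \<in> borel_measurable borel"
      by (intro borel_measurable_continuous_onI continuous_intros)
    show "(\<integral>\<^sup>+x\<in>?S. ennreal \<bar>?J x\<bar> \<partial>lborel) < \<infinity>"
      by (fact fin)
  qed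
  also note int
  also have "(\<integral>\<^sup>+\<theta>. ennreal (\<delta> \<theta>) * indicator A' \<theta> \<partial>lborel) =
      (\<integral>\<^sup>+\<theta>. ennreal (\<delta> \<theta>) * indicator (A \<inter> {0..<2 * pi}) \<theta> \<partial>lborel)"
    \<comment> \<open>Where the boundary point at angle \<open>\<theta>\<close> is \<open>\<mu>\<close> itself, the density vanishes.\<close>
    by (intro nn_integral_cong)
       (auto simp: A'_def \<delta>_def power2_eq_square [symmetric] split: split_indicator)
  finally show ?thesis
    unfolding image \<delta>_def .
qed

section \<open>The law of the shadow angle\<close>

theorem mainTheorem1:
  fixes M :: "'a measure" and U :: "'a \<Rightarrow> real \<times> real" and \<Theta> :: "'a \<Rightarrow> real"
    and \<rho> \<phi> :: real and \<mu> :: "real \<times> real"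
  assumes "prob_space M"
    and "0 \<le> \<rho>" and "\<rho> \<le> 1"
    and "\<mu> = (\<rho> * cos \<phi>, \<rho> * sin \<phi>)"
    and "U \<in> measurable M lborel"
    and "distr M lborel U = uniform_measure lborel unit_disc"
    and "\<And>\<omega>. \<omega> \<in> space M \<Longrightarrow> \<Theta> \<omega> = shadow_angle \<mu> (U \<omega>)"
  shows "absolutely_continuous lborel (distr M lborel \<Theta>) \<and>
    distributed M lborel \<Theta>
      (\<lambda>\<theta>. ennreal ((1 - \<rho> * cos (\<theta> - \<phi>)) / (2 * pi)) * indicator {0..<2 * pi} \<theta>)"
proof -
  let ?p = "\<lambda>\<theta>. ennreal ((1 - \<rho> * cos (\<theta> - \<phi>)) / (2 * pi)) * indicator {0..<2 * pi} \<theta>"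
  have \<mu>: "\<mu> \<in> unit_disc"
  proof -
    have "(\<rho> * cos \<phi>)\<^sup>2 + (\<rho> * sin \<phi>)\<^sup>2 = \<rho>\<^sup>2 * ((sin \<phi>)\<^sup>2 + (cos \<phi>)\<^sup>2)"
      by (simp add: power_mult_distrib distrib_left
               del: sin_cos_squared_add sin_cos_squared_add2)
    also have "\<dots> \<le> 1"
      using assms(2,3) by (simp add: power_le_one)
    finally show ?thesis
      by (simp add: assms(4) unit_disc_def)
  qed
  have inner: "\<mu> \<bullet> (cos \<theta>, sin \<theta>) = \<rho> * cos (\<theta> - \<phi>)" for \<theta>
    by (simp add: assms(4) cos_diff algebra_simps)
  have [measurable]: "shadow_angle \<mu> \<in> borel_measurable borel"
    by (rule borel_measurable_shadow_angle[OF \<mu>])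
  have [measurable]: "U \<in> measurable M borel"
    using assms(5) by simp
  have [measurable]: "unit_disc \<in> sets borel"
    by (simp add: unit_disc_eq_cball)
  have \<Theta>: "\<Theta> \<in> measurable M lborel"
    by (subst measurable_cong[OF assms(7)]) auto
  have p: "?p \<in> borel_measurable lborel"
    by measurable
  have area: "emeasure lborel unit_disc = ennreal pi"
    by (simp add: unit_disc_eq_cball emeasure_cball unit_ball_vol_2)
  \<comment> \<open>The factor \<open>1 / 2\<close> comes from the radial integral and the division
    by \<open>pi\<close> from normalising the area; together they give the constant of the
    density.\<close>
  have scale: "ennreal (1 / 2) * I / ennreal pi = ennreal (1 / (2 * pi)) * I" for I
  proof -
    have "ennreal (1 / 2) * I / ennreal pi = ennreal (1 / 2) * ennreal (inverse pi) * I"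
      by (simp only: divide_ennreal_def inverse_ennreal pi_gt_zero mult_ac)
    also have "ennreal (1 / 2) * ennreal (inverse pi) = ennreal (1 / 2 * inverse pi)"
      by (rule ennreal_mult [symmetric]) auto
    also have "1 / 2 * inverse pi = 1 / (2 * pi)"
      by (simp add: field_simps)
    finally show ?thesis .
  qed
  have "distr M lborel \<Theta> = density lborel ?p"
  proof (rule measure_eqI)
    fix A assume "A \<in> sets (distr M lborel \<Theta>)"
    then have [measurable]: "A \<in> sets borel" by simp
    let ?C = "{u. shadow_angle \<mu> u \<in> A}"
    have "?C \<in> sets borel" by measurable
    have "distr M lborel \<Theta> = distr (distr M lborel U) lborel (shadow_angle \<mu>)"
      using assms(5,7) by (subst distr_distr) (auto intro!: distr_cong)
    then have "emeasure (distr M lborel \<Theta>) A = emeasure (uniform_measure lborel unit_disc) ?C"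
      by (simp add: assms(6) emeasure_distr vimage_def)
    also have "\<dots> = emeasure lborel (unit_disc \<inter> ?C) / ennreal pi"
      using \<open>?C \<in> sets borel\<close> by (simp add: area)
    \<comment> \<open>The light source itself, where the angle is unspecified, is a single point and
      hence a null set.\<close>
    also have "emeasure lborel (unit_disc \<inter> ?C) =
        emeasure lborel (unit_disc \<inter> ?C - {\<mu>})"
      using \<open>?C \<in> sets borel\<close> by (intro emeasure_Diff_null_set [symmetric]) auto
    also have "unit_disc \<inter> ?C - {\<mu>} = {u \<in> unit_disc - {\<mu>}. shadow_angle \<mu> u \<in> A}"
      by auto
    also have "emeasure lborel \<dots> / ennreal pi =
        ennreal (1 / (2 * pi)) *
        (\<integral>\<^sup>+\<theta>\<in>A \<inter> {0..<2 * pi}. ennreal (1 - \<rho> * cos (\<theta> - \<phi>)) \<partial>lborel)"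
      unfolding emeasure_shadow_angle[OF \<mu> \<open>A \<in> sets borel\<close>] inner
      by (rule scale)
    \<comment> \<open>Nonnegativity of \<open>1 - \<rho> * cos (\<theta> - \<phi>)\<close> allows
      the constant to be merged into the argument of \<open>ennreal\<close>.\<close>
    also have "\<dots> = (\<integral>\<^sup>+\<theta>. ?p \<theta> * indicator A \<theta> \<partial>lborel)"
      using inner_disc_circle_le_1[OF \<mu>]
      by (subst nn_integral_cmult [symmetric])
         (auto simp: inner ennreal_mult [symmetric] intro!: nn_integral_cong
               split: split_indicator)
    also have "\<dots> = emeasure (density lborel ?p) A"
      by (subst emeasure_density) auto
    finally show "emeasure (distr M lborel \<Theta>) A = emeasure (density lborel ?p) A" .
  qed simp
  with \<Theta> p show ?thesis
    by (simp add: distributed_def absolutely_continuousI_density)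
qed

end
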